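(* Let $P$ be any poset and let $u\in P^*$. Then there are nondeterministic finite automata over $P$ accepting $\mathcal{F}(u)$, $\mathcal{S}(u)$, and $\mathcal{A}(u)$.
   Context: $P^*$ is the free monoid of finite words over $P$. Generalized factor order: $u\le w$ iff there is a factor $w'$ of $w$ (i.e. $w=xw'y$) with $|w'|=|u|$ and $u_i\le w'_i$ for all $i$; such $w'$ is an embedding of $u$ into $w$. $\mathcal{F}(u)=\{w:w\ge u\}$; $\mathcal{S}(u)$ is the set of $w\in\mathcal{F}(u)$ for which every embedding of $u$ into $w$ is a suffix of $w$; $\mathcal{A}(u)=\{w:w\not\ge u\}$. A nondeterministic finite automaton (NFA) over $P$ is a directed graph with finitely many vertices (states), a designated initial state, a set of final states, and each arc labeled by an element of $P$ (there may be infinitely many arcs if $P$ is infinite). The language it accepts is the set of words obtained by concatenating arc labels along directed paths from the initial state to a final state. *)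

theory Defs
  imports Main
begin

text \<open>A poset is given by \<open>partial_order_on P r\<close>, so the empty poset is included.
  The pair \<open>(a, b) \<in> r\<close> means \<open>a \<le> b\<close>, and \<open>lists P\<close> is the free monoid over \<open>P\<close>.\<close>

text \<open>An embedding is an occurrence of a factor: the surrounding words \<open>x\<close> and \<open>y\<close> are part of
  it, so equal factors at different positions of \<open>w\<close> are different embeddings.\<close>

definition embedding ::
  "('a \<times> 'a) set \<Rightarrow> 'a list \<Rightarrow> 'a list \<Rightarrow> 'a list \<Rightarrow> 'a list \<Rightarrow> 'a list \<Rightarrow> bool" where
  "embedding r u w x w' y \<longleftrightarrow>
     w = x @ w' @ y \<and> length w' = length u \<and> (\<forall>i < length u. (u ! i, w' ! i) \<in> r)"

definition gen_factor_le :: "('a \<times> 'a) set \<Rightarrow> 'a list \<Rightarrow> 'a list \<Rightarrow> bool" where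
  "gen_factor_le r u w \<longleftrightarrow> (\<exists>x w' y. embedding r u w x w' y)"

definition lang_F :: "'a set \<Rightarrow> ('a \<times> 'a) set \<Rightarrow> 'a list \<Rightarrow> 'a list set" where
  "lang_F P r u = {w \<in> lists P. gen_factor_le r u w}"

text \<open>The embedding \<open>(x, w', y)\<close> is a suffix of \<open>w\<close> precisely when nothing follows it.\<close>

definition lang_S :: "'a set \<Rightarrow> ('a \<times> 'a) set \<Rightarrow> 'a list \<Rightarrow> 'a list set" where
  "lang_S P r u = {w \<in> lang_F P r u. \<forall>x w' y. embedding r u w x w' y \<longrightarrow> y = []}"

definition lang_A :: "'a set \<Rightarrow> ('a \<times> 'a) set \<Rightarrow> 'a list \<Rightarrow> 'a list set" where
  "lang_A P r u = {w \<in> lists P. \<not> gen_factor_le r u w}"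

record ('s, 'a) nfa =
  states :: "'s set"
  init :: 's
  final :: "'s set"
  arcs :: "('s \<times> 'a \<times> 's) set"

text \<open>Only the set of states has to be finite; there may be infinitely many arcs.\<close>

definition nfa_over :: "'a set \<Rightarrow> ('s, 'a) nfa \<Rightarrow> bool" where
  "nfa_over P M \<longleftrightarrow> finite (states M) \<and> init M \<in> states M \<and> final M \<subseteq> states M \<and>
     arcs M \<subseteq> states M \<times> P \<times> states M"

inductive nfa_path :: "('s, 'a) nfa \<Rightarrow> 's \<Rightarrow> 'a list \<Rightarrow> 's \<Rightarrow> bool" for M where
  path_Nil: "q \<in> states M \<Longrightarrow> nfa_path M q [] q"
| path_Cons: "(p, a, q) \<in> arcs M \<Longrightarrow> nfa_path M q w s \<Longrightarrow> nfa_path M p (a # w) s"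

definition nfa_language :: "('s, 'a) nfa \<Rightarrow> 'a list set" where
  "nfa_language M = {w. \<exists>q \<in> final M. nfa_path M (init M) w q}"

text \<open>HOL cannot quantify existentially over the type of states. Taking states in \<open>nat\<close> loses
  nothing, since a finite set of states can be renamed to natural numbers.\<close>

definition nfa_acceptable :: "'a set \<Rightarrow> 'a list set \<Rightarrow> bool" where
  "nfa_acceptable P L \<longleftrightarrow> (\<exists>M :: (nat, 'a) nfa. nfa_over P M \<and> nfa_language M = L)"

end

theory Submission
  imports Defs
begin

text \<open>Reading a word letter by letter, remember which prefixes of \<open>u\<close> embed as a suffix of
  the part read so far, and whether \<open>u\<close> embedded before the last letter. This is a finite amount of
  information, updating it needs only the next letter, and it decides all three languages.\<close>

text \<open>This is the Myhill--Nerode construction: the values of \<open>f\<close> are the states.\<close>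

lemma nfa_acceptable_if_finite_invariant:
  fixes f :: "'a list \<Rightarrow> 's"
  assumes fin: "finite (f ` lists P)"
    and step: "\<And>v w a. \<lbrakk>v \<in> lists P; w \<in> lists P; a \<in> P; f v = f w\<rbrakk> \<Longrightarrow> f (v @ [a]) = f (w @ [a])"
    and sub: "L \<subseteq> lists P"
    and saturated: "\<And>v w. \<lbrakk>v \<in> L; w \<in> lists P; f v = f w\<rbrakk> \<Longrightarrow> w \<in> L"
  shows "nfa_acceptable P L"
proof -
  \<comment> \<open>Acceptability asks for states in \<open>nat\<close>, so the finitely many values
    of \<open>f\<close> are renamed injectively.\<close>
  obtain e :: "'s \<Rightarrow> nat" where "inj_on e (f ` lists P)"
    using finite_imp_inj_to_nat_seg[OF fin] by blast
  define g where "g = e \<circ> f"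
  have g_eq: "g v = g w \<longleftrightarrow> f v = f w" if "v \<in> lists P" "w \<in> lists P" for v w
    using \<open>inj_on e _\<close> that by (auto simp: g_def inj_on_eq_iff)
  define M where "M = \<lparr>states = g ` lists P, init = g [], final = g ` L,
    arcs = {(g w, a, g (w @ [a])) |w a. w \<in> lists P \<and> a \<in> P}\<rparr>"
  \<comment> \<open>The arcs are defined through an arbitrary representative \<open>w\<close> of a
    state. By \<open>step\<close> the target does not depend on this choice, so the automaton is
    deterministic.\<close>
  have arc: "(g v, a, q) \<in> arcs M \<longleftrightarrow> a \<in> P \<and> q = g (v @ [a])" if "v \<in> lists P" for v a q
  proof
    assume "(g v, a, q) \<in> arcs M"
    then obtain w where w: "w \<in> lists P" "a \<in> P" "g v = g w" "q = g (w @ [a])"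
      by (auto simp: M_def)
    then have "f (v @ [a]) = f (w @ [a])"
      using step g_eq that by blast
    then show "a \<in> P \<and> q = g (v @ [a])"
      using w by (simp add: g_def)
  qed (use that in \<open>auto simp: M_def\<close>)
  have path: "nfa_path M (g v) w q \<longleftrightarrow> w \<in> lists P \<and> q = g (v @ w)" if "v \<in> lists P" for v w q
    using that
  proof (induction w arbitrary: v)
    case Nil
    then show ?case
      by (subst nfa_path.simps) (auto simp: M_def)
  next
    case (Cons a w)
    have "nfa_path M (g v) (a # w) q \<longleftrightarrow> (\<exists>p. (g v, a, p) \<in> arcs M \<and> nfa_path M p w q)"
      by (subst nfa_path.simps) auto
    also have "\<dots> \<longleftrightarrow> a \<in> P \<and> nfa_path M (g (v @ [a])) w q"
      using arc Cons.prems by auto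
    finally show ?case
      using Cons.IH[of "v @ [a]"] Cons.prems by auto
  qed
  have "finite (g ` lists P)"
    unfolding g_def image_comp[symmetric] using fin by (rule finite_imageI)
  then have "nfa_over P M"
    using sub by (auto simp: nfa_over_def M_def intro!: imageI)
  moreover have "w \<in> nfa_language M \<longleftrightarrow> w \<in> L" for w
  proof -
    have "w \<in> nfa_language M \<longleftrightarrow> (\<exists>q \<in> g ` L. nfa_path M (g []) w q)"
      by (simp add: nfa_language_def M_def)
    also have "\<dots> \<longleftrightarrow> w \<in> lists P \<and> g w \<in> g ` L"
      using path[of "[]" w] by auto
    \<comment> \<open>A final state comes from some \<open>v\<close> in \<open>L\<close>, perhaps
      other than \<open>w\<close>; saturation carries membership over to \<open>w\<close>.\<close>
    also have "\<dots> \<longleftrightarrow> w \<in> L"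
    proof
      assume "w \<in> lists P \<and> g w \<in> g ` L"
      then obtain v where "v \<in> L" "g w = g v" "w \<in> lists P"
        by blast
      then show "w \<in> L"
        using g_eq[of v w] sub saturated[of v w] by (metis subsetD)
    qed (use sub in blast)
    finally show ?thesis .
  qed
  ultimately show ?thesis
    unfolding nfa_acceptable_def by blast
qed

definition suffix_embeds :: "('a \<times> 'a) set \<Rightarrow> 'a list \<Rightarrow> 'a list \<Rightarrow> bool" where
  "suffix_embeds r u w \<longleftrightarrow> (\<exists>x w'. embedding r u w x w' [])"

definition nonsuffix_embeds :: "('a \<times> 'a) set \<Rightarrow> 'a list \<Rightarrow> 'a list \<Rightarrow> bool" where
  "nonsuffix_embeds r u w \<longleftrightarrow> (\<exists>x w' y. embedding r u w x w' y \<and> y \<noteq> [])"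

text \<open>Tracking \<open>u\<close> alone would not allow updates: after a new letter, the status
  of a nonempty prefix depends on the earlier status of the prefix one letter shorter. Storing
  lengths rather than words keeps the range finite even for infinite alphabets.\<close>

definition profile :: "('a \<times> 'a) set \<Rightarrow> 'a list \<Rightarrow> 'a list \<Rightarrow> nat set \<times> bool" where
  "profile r u w = ({j. j \<le> length u \<and> suffix_embeds r (take j u) w}, nonsuffix_embeds r u w)"

lemma embedding_iff_list_all2:
  "embedding r u w x w' y \<longleftrightarrow> w = x @ w' @ y \<and> list_all2 (\<lambda>a b. (a, b) \<in> r) u w'"
  by (auto simp: embedding_def list_all2_conv_all_nth)

lemma suffix_embeds_Nil: "suffix_embeds r [] w"
  by (simp add: suffix_embeds_def embedding_iff_list_all2)

text \<open>In a suffix embedding the last letters are matched with each other, and the rest is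
  again a suffix embedding.\<close>

lemma suffix_embeds_snoc:
  "suffix_embeds r (u @ [b]) (w @ [a]) \<longleftrightarrow> suffix_embeds r u w \<and> (b, a) \<in> r"
proof
  assume "suffix_embeds r (u @ [b]) (w @ [a])"
  then show "suffix_embeds r u w \<and> (b, a) \<in> r"
    by (fastforce simp: suffix_embeds_def embedding_iff_list_all2 list_all2_append1 list_all2_Cons1)
next
  assume "suffix_embeds r u w \<and> (b, a) \<in> r"
  then obtain x w' where "embedding r (u @ [b]) (w @ [a]) x (w' @ [a]) []"
    by (auto simp: suffix_embeds_def embedding_iff_list_all2 intro: list_all2_appendI)
  then show "suffix_embeds r (u @ [b]) (w @ [a])"
    unfolding suffix_embeds_def by blast
qed

text \<open>An embedding followed by a nonempty remainder avoids the last letter \<open>a\<close>,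
  so it already lies in \<open>w\<close>; conversely, appending \<open>a\<close> makes every
  remainder nonempty.\<close>

lemma nonsuffix_embeds_snoc:
  "nonsuffix_embeds r u (w @ [a]) \<longleftrightarrow> suffix_embeds r u w \<or> nonsuffix_embeds r u w"
proof
  assume "nonsuffix_embeds r u (w @ [a])"
  then obtain x w' y where emb: "embedding r u (w @ [a]) x w' y" and "y \<noteq> []"
    unfolding nonsuffix_embeds_def by blast
  then obtain z where "y = z @ [a]" "w = x @ w' @ z"
    by (cases y rule: rev_cases) (auto simp: embedding_iff_list_all2)
  then have "embedding r u w x w' z"
    using emb by (simp add: embedding_iff_list_all2)
  then show "suffix_embeds r u w \<or> nonsuffix_embeds r u w"
    unfolding suffix_embeds_def nonsuffix_embeds_def by blast
next
  assume "suffix_embeds r u w \<or> nonsuffix_embeds r u w"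
  then obtain x w' y where "embedding r u w x w' y"
    unfolding suffix_embeds_def nonsuffix_embeds_def by blast
  then have "embedding r u (w @ [a]) x w' (y @ [a])"
    by (simp add: embedding_iff_list_all2)
  then show "nonsuffix_embeds r u (w @ [a])"
    unfolding nonsuffix_embeds_def by blast
qed

lemma gen_factor_le_iff: "gen_factor_le r u w \<longleftrightarrow> suffix_embeds r u w \<or> nonsuffix_embeds r u w"
  unfolding gen_factor_le_def suffix_embeds_def nonsuffix_embeds_def by metis

lemma lang_S_iff:
  "w \<in> lang_S P r u \<longleftrightarrow> w \<in> lists P \<and> suffix_embeds r u w \<and> \<not> nonsuffix_embeds r u w"
  unfolding lang_S_def lang_F_def gen_factor_le_iff nonsuffix_embeds_def by blast

lemma profile_eqD:
  assumes "profile r u v = profile r u w"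
  shows "j \<le> length u \<Longrightarrow> suffix_embeds r (take j u) v \<longleftrightarrow> suffix_embeds r (take j u) w"
    and "suffix_embeds r u v \<longleftrightarrow> suffix_embeds r u w"
    and "nonsuffix_embeds r u v \<longleftrightarrow> nonsuffix_embeds r u w"
proof -
  show *: "suffix_embeds r (take j u) v \<longleftrightarrow> suffix_embeds r (take j u) w" if "j \<le> length u" for j
    using assms that by (auto simp: profile_def)
  show "suffix_embeds r u v \<longleftrightarrow> suffix_embeds r u w"
    \<comment> \<open>The bound on \<open>j\<close> in \<open>profile\<close> is not strict, so
      \<open>u\<close> itself is among the tracked prefixes.\<close>
    using *[of "length u"] by simp
  show "nonsuffix_embeds r u v \<longleftrightarrow> nonsuffix_embeds r u w"
    using assms by (simp add: profile_def)
qed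

lemma profile_snoc_cong:
  assumes "profile r u v = profile r u w"
  shows "profile r u (v @ [a]) = profile r u (w @ [a])"
proof -
  have "suffix_embeds r (take j u) (v @ [a]) \<longleftrightarrow> suffix_embeds r (take j u) (w @ [a])"
    if "j \<le> length u" for j
  \<comment> \<open>For \<open>j = Suc i\<close> the new letter is compared with
    \<open>u ! i\<close> and the rest is the known status of \<open>take i u\<close>; the empty
    prefix always embeds.\<close>
  proof (cases j)
    case (Suc i)
    then show ?thesis
      using profile_eqD(1)[OF assms, of i] that
      by (simp add: take_Suc_conv_app_nth suffix_embeds_snoc)
  qed (simp add: suffix_embeds_Nil)
  then show ?thesis
    using profile_eqD(2,3)[OF assms] by (auto simp: profile_def nonsuffix_embeds_snoc)
qed

lemma finite_range_profile: "finite (range (profile r u))"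
proof (rule finite_subset)
  show "range (profile r u) \<subseteq> Pow {..length u} \<times> UNIV"
    by (auto simp: profile_def)
qed simp

theorem theorem2p2:
  fixes P :: "'a set" and r :: "('a \<times> 'a) set" and u :: "'a list"
  assumes "partial_order_on P r" and "u \<in> lists P"
  shows "nfa_acceptable P (lang_F P r u) \<and>
         nfa_acceptable P (lang_S P r u) \<and>
         nfa_acceptable P (lang_A P r u)"
proof -
  \<comment> \<open>It remains to see that each language is a union of profile classes, since
    membership of a word over \<open>P\<close> is a Boolean combination of
    \<open>suffix_embeds r u\<close> and \<open>nonsuffix_embeds r u\<close>.\<close>
  have accept: "nfa_acceptable P L"
    if "L \<subseteq> lists P"
      and "\<And>v w. \<lbrakk>v \<in> L; w \<in> lists P; profile r u v = profile r u w\<rbrakk> \<Longrightarrow> w \<in> L" for L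
  proof (rule nfa_acceptable_if_finite_invariant)
    show "finite (profile r u ` lists P)"
      using finite_range_profile by (rule finite_subset[rotated]) blast
  qed (use that in \<open>auto intro: profile_snoc_cong\<close>)
  show ?thesis
    by (intro conjI accept)
      (auto simp: lang_F_def lang_A_def lang_S_iff gen_factor_le_iff dest: profile_eqD(2,3))
qed

end
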